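(* Let $S$ be a finite approximation space, let $Q=\wp(S)/{\approx}$ be the associated pre-rough algebra of roughly equal objects, and let $K\subseteq Q$ be an L-filter, with induced partial algebraic system $\mathbb{K}=\langle K,\leq,L,U,\neg,1\rangle$. Then $\mathbb{K}$ satisfies: 1. the restriction of $\leq$ to $K$ is a join-semilattice order (with join $\sqcup$); 2. $K$ is closed under $L$ and $U$; 3. for all $x,a,b\in K$: $Lx\leq x$; $L(a\sqcap b)\stackrel{w}{=}La\sqcap Lb$; $LLx=Lx$; 4. $L1=1$; and for all $x,y,a,b\in K$: $ULx=Lx$; $L(a\sqcup b)=La\sqcup Lb$; $x\sqcup(y\sqcap x)\stackrel{w}{=}x$; 5. for all $x,y,z\in K$: $x\sqcup(y\sqcap z)\stackrel{w}{=}(x\sqcup y)\sqcap(x\sqcup z)$ and $x\sqcap(y\sqcup z)\stackrel{w}{=}(x\sqcap y)\sqcup(x\sqcap z)$. However, $K$ need not be closed under $\sqcap$ and need not be closed under $\neg$ (i.e., there are examples of $S$ and L-filters $K$ for which these closures fail).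
   Context: An approximation space is a set $S$ with an equivalence relation $R$. For $A\subseteq S$, $A^{l}$ is the union of the $R$-classes contained in $A$ and $A^{u}$ is the union of the $R$-classes meeting $A$. Sets $A,B\subseteq S$ are roughly equal, $A\approx B$, iff $A^{l}=B^{l}$ and $A^{u}=B^{u}$. On $Q=\wp(S)/{\approx}$ the rough inclusion order is $[A]\leq[B]$ iff $A^{l}\subseteq B^{l}$ and $A^{u}\subseteq B^{u}$; this is a distributive lattice order, with join $\sqcup$ and meet $\sqcap$, least element $0=[\emptyset]$ and greatest element $1=[S]$. The unary operations are $L[A]=[A^{l}]$, $U[A]=[A^{u}]$, $\neg[A]=[S\setminus A]$. A nonempty subset $K\subseteq Q$ is an L-filter iff: (F0) for all $x\in K$ and $y\in Q$, $x\leq y$ implies $y\in K$; and (O1) for all $x\in K$, $Lx\in K$. The operations on $\mathbb{K}$ are the partial operations induced from $Q$: an operation is defined on given arguments from $K$ iff its value in $Q$ lies in $K$, and then has that value. The weak equality $p\stackrel{w}{=}q$ of two terms means: whenever both sides are defined (in $\mathbb{K}$), they are equal. *)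

theory Defs
  imports "HOL-Algebra.Lattice"
begin

definition finite_approx_space :: "'a set \<Rightarrow> 'a rel \<Rightarrow> bool" where
  "finite_approx_space S R \<longleftrightarrow> finite S \<and> equiv S R"

definition lower_approx :: "'a set \<Rightarrow> 'a rel \<Rightarrow> 'a set \<Rightarrow> 'a set" where
  "lower_approx S R A = \<Union> {C \<in> S // R. C \<subseteq> A}"

definition upper_approx :: "'a set \<Rightarrow> 'a rel \<Rightarrow> 'a set \<Rightarrow> 'a set" where
  "upper_approx S R A = \<Union> {C \<in> S // R. C \<inter> A \<noteq> {}}"

definition rough_eq :: "'a set \<Rightarrow> 'a rel \<Rightarrow> 'a set rel" where
  "rough_eq S R = {(A, B). A \<subseteq> S \<and> B \<subseteq> S \<and>
     lower_approx S R A = lower_approx S R B \<and> upper_approx S R A = upper_approx S R B}"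

definition rough_class :: "'a set \<Rightarrow> 'a rel \<Rightarrow> 'a set \<Rightarrow> 'a set set" where
  "rough_class S R A = rough_eq S R `` {A}"

definition rough_objects :: "'a set \<Rightarrow> 'a rel \<Rightarrow> 'a set set set" where
  "rough_objects S R = Pow S // rough_eq S R"

definition rough_le :: "'a set \<Rightarrow> 'a rel \<Rightarrow> 'a set set \<Rightarrow> 'a set set \<Rightarrow> bool" where
  "rough_le S R x y \<longleftrightarrow> (\<exists>A\<in>x. \<exists>B\<in>y.
     lower_approx S R A \<subseteq> lower_approx S R B \<and> upper_approx S R A \<subseteq> upper_approx S R B)"

text \<open>The library's binary supremum \<open>\<squnion>\<close> and infimum \<open>\<sqinter>\<close> of this ordered structure are the join and
  meet of rough objects.\<close>

definition rough_order :: "'a set \<Rightarrow> 'a rel \<Rightarrow> 'a set set gorder" where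
  "rough_order S R = \<lparr>carrier = rough_objects S R, eq = (=), le = rough_le S R\<rparr>"

text \<open>In the next three definitions the sets in the union all coincide when \<open>x\<close> is a rough object, so that the
  union is their common value; see \<open>rough_L_class\<close>, \<open>rough_U_class\<close> and \<open>rough_neg_class\<close> below.\<close>

definition rough_L :: "'a set \<Rightarrow> 'a rel \<Rightarrow> 'a set set \<Rightarrow> 'a set set" where
  "rough_L S R x = (\<Union>A\<in>x. rough_class S R (lower_approx S R A))"

definition rough_U :: "'a set \<Rightarrow> 'a rel \<Rightarrow> 'a set set \<Rightarrow> 'a set set" where
  "rough_U S R x = (\<Union>A\<in>x. rough_class S R (upper_approx S R A))"

definition rough_neg :: "'a set \<Rightarrow> 'a rel \<Rightarrow> 'a set set \<Rightarrow> 'a set set" where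
  "rough_neg S R x = (\<Union>A\<in>x. rough_class S R (S - A))"

definition L_filter :: "'a set \<Rightarrow> 'a rel \<Rightarrow> 'a set set set \<Rightarrow> bool" where
  "L_filter S R K \<longleftrightarrow> K \<noteq> {} \<and> K \<subseteq> rough_objects S R \<and>
     (\<forall>x\<in>K. \<forall>y\<in>rough_objects S R. rough_le S R x y \<longrightarrow> y \<in> K) \<and>
     (\<forall>x\<in>K. rough_L S R x \<in> K)"

text \<open>Terms over the partial operations induced on \<open>K\<close>, with elements of \<open>K\<close> substituted for the
  variables.  A term is defined iff all its immediate subterms are defined and the value
  in the full algebra of rough objects lies in \<open>K\<close>.\<close>

datatype 'q rough_term =
    Elem 'q
  | One
  | Lo "'q rough_term"
  | Up "'q rough_term"
  | Neg "'q rough_term"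
  | Join "'q rough_term" "'q rough_term"
  | Meet "'q rough_term" "'q rough_term"

definition restrict_value :: "'q set \<Rightarrow> 'q \<Rightarrow> 'q option" where
  "restrict_value K q = (if q \<in> K then Some q else None)"

primrec partial_value ::
    "'a set \<Rightarrow> 'a rel \<Rightarrow> 'a set set set \<Rightarrow> 'a set set rough_term \<Rightarrow> 'a set set option" where
  "partial_value S R K (Elem x) = restrict_value K x"
| "partial_value S R K One = restrict_value K (rough_class S R S)"
| "partial_value S R K (Lo t) =
     Option.bind (partial_value S R K t) (\<lambda>x. restrict_value K (rough_L S R x))"
| "partial_value S R K (Up t) =
     Option.bind (partial_value S R K t) (\<lambda>x. restrict_value K (rough_U S R x))"
| "partial_value S R K (Neg t) =
     Option.bind (partial_value S R K t) (\<lambda>x. restrict_value K (rough_neg S R x))"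
| "partial_value S R K (Join s t) =
     Option.bind (partial_value S R K s) (\<lambda>x. Option.bind (partial_value S R K t)
       (\<lambda>y. restrict_value K (x \<squnion>\<^bsub>rough_order S R\<^esub> y)))"
| "partial_value S R K (Meet s t) =
     Option.bind (partial_value S R K s) (\<lambda>x. Option.bind (partial_value S R K t)
       (\<lambda>y. restrict_value K (x \<sqinter>\<^bsub>rough_order S R\<^esub> y)))"

definition weak_eq ::
    "'a set \<Rightarrow> 'a rel \<Rightarrow> 'a set set set \<Rightarrow> 'a set set rough_term \<Rightarrow> 'a set set rough_term \<Rightarrow> bool" where
  "weak_eq S R K s t \<longleftrightarrow>
     (\<forall>p q. partial_value S R K s = Some p \<and> partial_value S R K t = Some q \<longrightarrow> p = q)"

text \<open>An ordinary equation between partial terms asserts that both sides are defined and equal.\<close>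

definition strong_eq ::
    "'a set \<Rightarrow> 'a rel \<Rightarrow> 'a set set set \<Rightarrow> 'a set set rough_term \<Rightarrow> 'a set set rough_term \<Rightarrow> bool" where
  "strong_eq S R K s t \<longleftrightarrow>
     (\<exists>p. partial_value S R K s = Some p \<and> partial_value S R K t = Some p)"

lemma lower_approx_subset: "equiv S R \<Longrightarrow> lower_approx S R A \<subseteq> S"
  unfolding lower_approx_def using in_quotient_imp_subset by fastforce

lemma upper_approx_subset: "equiv S R \<Longrightarrow> upper_approx S R A \<subseteq> S"
  unfolding upper_approx_def using in_quotient_imp_subset by fastforce

lemma equiv_rough_eq: "equiv (Pow S) (rough_eq S R)"
  by (rule equivI) (auto simp: rough_eq_def refl_on_def sym_def trans_def)

lemma rough_class_self: "A \<subseteq> S \<Longrightarrow> A \<in> rough_class S R A"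
  by (simp add: rough_class_def rough_eq_def)

lemma rough_le_class:
  assumes "A \<subseteq> S" "B \<subseteq> S"
  shows "rough_le S R (rough_class S R A) (rough_class S R B) \<longleftrightarrow>
    lower_approx S R A \<subseteq> lower_approx S R B \<and> upper_approx S R A \<subseteq> upper_approx S R B"
  using assms by (auto simp: rough_le_def rough_class_def rough_eq_def)

lemma rough_L_class:
  assumes "A \<subseteq> S"
  shows "rough_L S R (rough_class S R A) = rough_class S R (lower_approx S R A)"
  using assms rough_class_self[OF assms, of R]
  by (auto simp: rough_L_def rough_class_def rough_eq_def)

lemma rough_U_class:
  assumes "A \<subseteq> S"
  shows "rough_U S R (rough_class S R A) = rough_class S R (upper_approx S R A)"
  using assms rough_class_self[OF assms, of R]
  by (auto simp: rough_U_def rough_class_def rough_eq_def)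

lemma lower_approx_compl:
  assumes "equiv S R" "A \<subseteq> S"
  shows "lower_approx S R (S - A) = S - upper_approx S R A"
proof -
  have "lower_approx S R (S - A) = \<Union> {C \<in> S // R. C \<inter> A = {}}"
  proof -
    have "C \<subseteq> S - A \<longleftrightarrow> C \<inter> A = {}" if "C \<in> S // R" for C
      using in_quotient_imp_subset[OF assms(1) that] by blast
    then show ?thesis unfolding lower_approx_def by metis
  qed
  also have "\<dots> = S - upper_approx S R A"
  proof -
    have "x \<notin> upper_approx S R A \<longleftrightarrow> x \<in> \<Union> {C \<in> S // R. C \<inter> A = {}}" if "x \<in> S" for x
    proof -
      obtain C where C: "C \<in> S // R" "x \<in> C"
        using Union_quotient[OF assms(1)] \<open>x \<in> S\<close> by blast
      then have "D = C" if "D \<in> S // R" "x \<in> D" for D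
        using quotient_disj[OF assms(1) C(1) that(1)] C(2) that(2) by blast
      then show ?thesis unfolding upper_approx_def using C by blast
    qed
    moreover have "\<Union> {C \<in> S // R. C \<inter> A = {}} \<subseteq> S"
      using Union_quotient[OF assms(1)] by blast
    ultimately show ?thesis by blast
  qed
  finally show ?thesis .
qed

lemma upper_approx_compl:
  assumes "equiv S R" "A \<subseteq> S"
  shows "upper_approx S R (S - A) = S - lower_approx S R A"
  using lower_approx_compl[of S R "S - A"] assms upper_approx_subset[of S R "S - A"]
  by (auto simp: double_diff)

lemma rough_neg_class:
  assumes "equiv S R" "A \<subseteq> S"
  shows "rough_neg S R (rough_class S R A) = rough_class S R (S - A)"
proof -
  have "rough_class S R (S - B) = rough_class S R (S - A)" if "B \<in> rough_class S R A" for B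
    using that assms
    by (auto simp: rough_class_def rough_eq_def lower_approx_compl upper_approx_compl)
  then show ?thesis
    unfolding rough_neg_def using rough_class_self[OF assms(2), of R] by blast
qed

end

theory Submission
  imports Defs
begin

text \<open>A rough object is determined by the pair consisting of its lower and its upper approximation.
  In these coordinates all operations act componentwise on sets: \<open>\<squnion>\<close> and \<open>\<sqinter>\<close> are union and
  intersection, \<open>L\<close> duplicates the lower and \<open>U\<close> the upper component. The only point that needs a
  construction is that the componentwise intersection of two such pairs is again realised by a set.
  The equations then hold in all of \<open>Q\<close>, and an L-filter is closed under the operations \<open>\<squnion>\<close> and \<open>U\<close>
  because these increase their arguments. Over the discrete space on two points \<open>Q\<close> is the
  four-element Boolean algebra, whose nonzero elements form an L-filter that is closed neither
  under \<open>\<sqinter>\<close> nor under \<open>\<not>\<close>.\<close>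

locale approx_space =
  fixes S :: "'a set" and R :: "'a rel"
  assumes equiv: "equiv S R"
begin

abbreviation Q where "Q \<equiv> rough_objects S R"
abbreviation low where "low \<equiv> lower_approx S R"
abbreviation upp where "upp \<equiv> upper_approx S R"
abbreviation cls where "cls \<equiv> rough_class S R"

text \<open>All members of a rough object share both approximations, so on a rough object these
  unions are the common values: the two coordinates used throughout.\<close>

definition obj_low :: "'a set set \<Rightarrow> 'a set" where "obj_low x = (\<Union>A\<in>x. low A)"
definition obj_upp :: "'a set set \<Rightarrow> 'a set" where "obj_upp x = (\<Union>A\<in>x. upp A)"

section \<open>Approximations point by point, and pairs realised by sets\<close>

lemma relatedD: "(a, b) \<in> R \<Longrightarrow> R `` {a} = R `` {b} \<and> a \<in> S \<and> b \<in> S"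
  by (rule equiv_class_eq_iff[OF equiv, THEN iffD1])

text \<open>Classes that share a point coincide, so the only class that can put \<open>a\<close>
  into \<open>low A\<close> is its own.\<close>

lemma low_iff: "a \<in> low A \<longleftrightarrow> a \<in> S \<and> R `` {a} \<subseteq> A"
proof
  assume "a \<in> low A"
  then obtain b where b: "b \<in> S" "a \<in> R `` {b}" "R `` {b} \<subseteq> A"
    unfolding lower_approx_def quotient_def by blast
  then have "R `` {b} = R `` {a} \<and> b \<in> S \<and> a \<in> S"
    by (intro relatedD) simp
  then show "a \<in> S \<and> R `` {a} \<subseteq> A"
    using b by simp
next
  assume "a \<in> S \<and> R `` {a} \<subseteq> A"
  then show "a \<in> low A"
    unfolding lower_approx_def quotient_def using equiv_class_self[OF equiv] by blast
qed

lemma upp_iff: "a \<in> upp A \<longleftrightarrow> a \<in> S \<and> R `` {a} \<inter> A \<noteq> {}"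
proof
  assume "a \<in> upp A"
  then obtain b where b: "b \<in> S" "a \<in> R `` {b}" "R `` {b} \<inter> A \<noteq> {}"
    unfolding upper_approx_def quotient_def by blast
  then have "R `` {b} = R `` {a} \<and> b \<in> S \<and> a \<in> S"
    by (intro relatedD) simp
  then show "a \<in> S \<and> R `` {a} \<inter> A \<noteq> {}"
    using b by simp
next
  assume "a \<in> S \<and> R `` {a} \<inter> A \<noteq> {}"
  then show "a \<in> upp A"
    unfolding upper_approx_def quotient_def using equiv_class_self[OF equiv] by blast
qed

lemma related_low_iff: "(a, b) \<in> R \<Longrightarrow> a \<in> low A \<longleftrightarrow> b \<in> low A"
  by (drule relatedD) (simp add: low_iff)

lemma related_upp_iff: "(a, b) \<in> R \<Longrightarrow> a \<in> upp A \<longleftrightarrow> b \<in> upp A"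
  by (drule relatedD) (simp add: upp_iff)

lemma related_refl: "a \<in> S \<Longrightarrow> (a, a) \<in> R"
  using equiv_class_self[OF equiv] by blast

lemma subset_upp: "A \<subseteq> S \<Longrightarrow> A \<subseteq> upp A"
  using related_refl upp_iff by blast

lemma low_subset_upp: "low A \<subseteq> upp A"
proof
  fix a assume "a \<in> low A"
  then have "a \<in> S" "R `` {a} \<subseteq> A" by (simp_all add: low_iff)
  then show "a \<in> upp A" using related_refl upp_iff by blast
qed

text \<open>A set closed under \<open>R\<close> is a union of classes, so a class lies inside it as
  soon as it meets it. Approximations are of this kind; approximating them again changes
  nothing.\<close>

lemma saturated_fixed:
  assumes "B \<subseteq> S" "\<And>a b. (a, b) \<in> R \<Longrightarrow> a \<in> B \<longleftrightarrow> b \<in> B"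
  shows "low B = B" "upp B = B"
proof -
  have "R `` {a} \<subseteq> B \<longleftrightarrow> a \<in> B" "R `` {a} \<inter> B \<noteq> {} \<longleftrightarrow> a \<in> B" if "a \<in> S" for a
    using assms(2) related_refl[OF that] by blast+
  then have "a \<in> low B \<longleftrightarrow> a \<in> B" "a \<in> upp B \<longleftrightarrow> a \<in> B" for a
    using subsetD[OF assms(1), of a] low_iff[of a B] upp_iff[of a B] by metis+
  then show "low B = B" "upp B = B" by auto
qed

lemmas saturated_low = saturated_fixed[OF lower_approx_subset[OF equiv] related_low_iff]
lemmas saturated_upp = saturated_fixed[OF upper_approx_subset[OF equiv] related_upp_iff]

lemma low_space: "low S = S"
  using equiv_type[OF equiv] by (auto simp: low_iff)

lemma upp_space: "upp S = S"
  using subset_upp[of S] upper_approx_subset[OF equiv, of S] by blast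

text \<open>The witness equals \<open>A \<inter> B\<close> on the classes inside \<open>A\<close> and all of \<open>A\<close> on those other classes
  that meet \<open>B\<close>; the plain intersection fails where \<open>A\<close> and \<open>B\<close> meet a class in disjoint sets.\<close>

lemma ex_meet:
  assumes "A \<subseteq> S" "B \<subseteq> S"
  shows "\<exists>M\<subseteq>S. low M = low A \<inter> low B \<and> upp M = upp A \<inter> upp B"
proof -
  define M where "M = (low A \<inter> B) \<union> ((A - low A) \<inter> upp B)"
  \<comment> \<open>\<open>low A\<close> and \<open>upp B\<close> are unions of classes, so the case
    that applies is constant along the class of \<open>a\<close>.\<close>
  have mem: "b \<in> M \<longleftrightarrow> (if a \<in> low A then b \<in> B else b \<in> A \<and> a \<in> upp B)"
    if "(a, b) \<in> R" for a b
    using that related_low_iff[OF that, of A] related_upp_iff[OF that, of B]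
    by (auto simp: M_def)
  have "M \<subseteq> S" using assms by (auto simp: M_def)
  moreover have "low M = low A \<inter> low B"
  proof (intro Set.set_eqI)
    fix a
    \<comment> \<open>Off \<open>low A\<close> the trace of \<open>M\<close> stays inside
      \<open>A\<close> and so misses part of the class; on \<open>low A\<close> it is the trace of
      \<open>B\<close>.\<close>
    have "R `` {a} \<subseteq> M \<longleftrightarrow> R `` {a} \<subseteq> A \<and> R `` {a} \<subseteq> B" if "a \<in> S"
      using mem[of a] that related_refl[OF that] by (cases "a \<in> low A") (auto simp: low_iff)
    then show "a \<in> low M \<longleftrightarrow> a \<in> low A \<inter> low B"
      by (auto simp: low_iff)
  qed
  moreover have "upp M = upp A \<inter> upp B"
  proof (intro Set.set_eqI)
    fix a
    have "R `` {a} \<inter> M \<noteq> {} \<longleftrightarrow> a \<in> upp A \<and> a \<in> upp B" if "a \<in> S"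
    proof (cases "a \<in> low A")
      case True
      then have "a \<in> upp A" using low_subset_upp by blast
      moreover have "R `` {a} \<inter> M = R `` {a} \<inter> B" using True mem[of a] by auto
      ultimately show ?thesis using that by (simp add: upp_iff)
    next
      case False
      \<comment> \<open>A class meeting \<open>B\<close> keeps its full trace of \<open>A\<close>
        and any other contributes nothing, so both conditions are tested at once.\<close>
      then have "R `` {a} \<inter> M = (if a \<in> upp B then R `` {a} \<inter> A else {})"
        using mem[of a] by auto
      then show ?thesis using that by (simp add: upp_iff)
    qed
    then show "a \<in> upp M \<longleftrightarrow> a \<in> upp A \<inter> upp B"
      by (auto simp: upp_iff[of a M] upp_iff[of a A])
  qed
  ultimately show ?thesis by blast
qed

text \<open>De Morgan: complementation exchanges lower and upper approximation, so the complement of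
  a meet witness for the complements serves.\<close>

lemma ex_join:
  assumes "A \<subseteq> S" "B \<subseteq> S"
  shows "\<exists>J\<subseteq>S. low J = low A \<union> low B \<and> upp J = upp A \<union> upp B"
proof -
  obtain M where M: "M \<subseteq> S" "low M = low (S - A) \<inter> low (S - B)"
      "upp M = upp (S - A) \<inter> upp (S - B)"
    using ex_meet[of "S - A" "S - B"] by blast
  show ?thesis
    using M assms lower_approx_subset[OF equiv] upper_approx_subset[OF equiv]
    by (intro exI[of _ "S - M"])
      (auto simp: lower_approx_compl[OF equiv] upper_approx_compl[OF equiv], blast+)
qed

section \<open>Rough objects in coordinates\<close>

lemma cls_in: "A \<subseteq> S \<Longrightarrow> cls A \<in> Q"
  by (auto simp: rough_objects_def rough_class_def intro: quotientI)

lemma objE: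
  assumes "x \<in> Q"
  obtains A where "A \<subseteq> S" "x = cls A"
  using assms by (auto simp: rough_objects_def rough_class_def elim: quotientE)

lemma obj_low_cls [simp]: "A \<subseteq> S \<Longrightarrow> obj_low (cls A) = low A"
  by (auto simp: obj_low_def rough_class_def rough_eq_def)

lemma obj_upp_cls [simp]: "A \<subseteq> S \<Longrightarrow> obj_upp (cls A) = upp A"
  by (auto simp: obj_upp_def rough_class_def rough_eq_def)

lemma rough_le_iff:
  "x \<in> Q \<Longrightarrow> y \<in> Q \<Longrightarrow> rough_le S R x y \<longleftrightarrow> obj_low x \<subseteq> obj_low y \<and> obj_upp x \<subseteq> obj_upp y"
  by (elim objE) (simp add: rough_le_class)

lemma cls_eqI: "low A = low B \<Longrightarrow> upp A = upp B \<Longrightarrow> A \<subseteq> S \<Longrightarrow> B \<subseteq> S \<Longrightarrow> cls A = cls B"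
  by (simp add: rough_class_def rough_eq_def)

text \<open>Injectivity of the coordinates; it reduces every identity in \<open>Q\<close> to two
  identities of sets.\<close>

lemma obj_eqI:
  assumes "x \<in> Q" "y \<in> Q" "obj_low x = obj_low y" "obj_upp x = obj_upp y"
  shows "x = y"
proof -
  obtain A B where "A \<subseteq> S" "x = cls A" "B \<subseteq> S" "y = cls B"
    using assms(1,2) by (elim objE)
  then show ?thesis
    using assms(3,4) cls_eqI[of A B] by simp
qed

lemma obj_low_subset_upp: "x \<in> Q \<Longrightarrow> obj_low x \<subseteq> obj_upp x"
  by (elim objE) (simp add: low_subset_upp)

text \<open>\<open>low A\<close> is a union of classes and thus equals both of its own
  approximations.\<close>

lemma rough_L_props:
  assumes "x \<in> Q"
  shows "rough_L S R x \<in> Q" "obj_low (rough_L S R x) = obj_low x"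
    "obj_upp (rough_L S R x) = obj_low x"
  using assms lower_approx_subset[OF equiv]
  by (auto elim!: objE simp: rough_L_class cls_in saturated_low)

lemma rough_U_props:
  assumes "x \<in> Q"
  shows "rough_U S R x \<in> Q" "obj_low (rough_U S R x) = obj_upp x"
    "obj_upp (rough_U S R x) = obj_upp x"
  using assms upper_approx_subset[OF equiv]
  by (auto elim!: objE simp: rough_U_class cls_in saturated_upp)

section \<open>The order of rough objects, its joins and meets\<close>

lemma partial_order_restrict:
  assumes "K \<subseteq> Q"
  shows "partial_order (rough_order S R\<lparr>carrier := K\<rparr>)"
proof -
  have le: "rough_le S R x y \<longleftrightarrow> obj_low x \<subseteq> obj_low y \<and> obj_upp x \<subseteq> obj_upp y"
    if "x \<in> K" "y \<in> K" for x y
    using that by (intro rough_le_iff subsetD[OF assms])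
  have refl: "rough_le S R x x" if "x \<in> K" for x
    using that by (simp add: le)
  have antisym: "x = y" if "x \<in> K" "y \<in> K" "rough_le S R x y" "rough_le S R y x" for x y
    using that by (intro obj_eqI subsetD[OF assms] subset_antisym) (simp_all add: le)
  have trans: "rough_le S R x z"
    if "x \<in> K" "y \<in> K" "z \<in> K" "rough_le S R x y" "rough_le S R y z" for x y z
    using that by (auto simp: le)
  show ?thesis
  proof
    fix x y z
    assume "x \<in> carrier (rough_order S R\<lparr>carrier := K\<rparr>)"
      "y \<in> carrier (rough_order S R\<lparr>carrier := K\<rparr>)"
      "z \<in> carrier (rough_order S R\<lparr>carrier := K\<rparr>)"
      "x \<sqsubseteq>\<^bsub>rough_order S R\<lparr>carrier := K\<rparr>\<^esub> y"
      "y \<sqsubseteq>\<^bsub>rough_order S R\<lparr>carrier := K\<rparr>\<^esub> z"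
    then show "x \<sqsubseteq>\<^bsub>rough_order S R\<lparr>carrier := K\<rparr>\<^esub> z"
      using trans[of x y z] by (simp add: rough_order_def)
  next
    fix x y
    assume "x \<sqsubseteq>\<^bsub>rough_order S R\<lparr>carrier := K\<rparr>\<^esub> y" "y \<sqsubseteq>\<^bsub>rough_order S R\<lparr>carrier := K\<rparr>\<^esub> x"
      "x \<in> carrier (rough_order S R\<lparr>carrier := K\<rparr>)"
      "y \<in> carrier (rough_order S R\<lparr>carrier := K\<rparr>)"
    then show "x .=\<^bsub>rough_order S R\<lparr>carrier := K\<rparr>\<^esub> y"
      using antisym[of x y] by (simp add: rough_order_def)
  qed (simp_all add: rough_order_def refl)
qed

lemma rough_order_carrier: "rough_order S R\<lparr>carrier := Q\<rparr> = rough_order S R"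
  by (simp add: rough_order_def)

lemma partial_order_rough_order: "partial_order (rough_order S R)"
  using partial_order_restrict[of Q] by (simp add: rough_order_carrier)

text \<open>The carrier is left general for two uses: with \<open>Q\<close> it identifies the join,
  and with an L-filter it shows that this join is still least among the upper bounds inside the
  filter.\<close>

lemma least_Upper_restrict:
  assumes "K \<subseteq> Q" "x \<in> K" "y \<in> K" "J \<in> K"
    and J: "obj_low J = obj_low x \<union> obj_low y" "obj_upp J = obj_upp x \<union> obj_upp y"
  shows "least (rough_order S R\<lparr>carrier := K\<rparr>) J (Upper (rough_order S R\<lparr>carrier := K\<rparr>) {x, y})"
proof (rule least_UpperI)
  have Q: "x \<in> Q" "y \<in> Q" "J \<in> Q" using assms(1-4) by auto
  {
    fix a assume "a \<in> {x, y}"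
    then have "rough_le S R a J"
      using J Q by (elim insertE emptyE) (simp_all add: rough_le_iff)
    then show "a \<sqsubseteq>\<^bsub>rough_order S R\<lparr>carrier := K\<rparr>\<^esub> J" by (simp add: rough_order_def)
  next
    fix u assume "u \<in> Upper (rough_order S R\<lparr>carrier := K\<rparr>) {x, y}"
    then have "u \<in> Q" "rough_le S R x u" "rough_le S R y u"
      using assms(1-3) by (simp_all add: Upper_def rough_order_def subsetD)
    then have "rough_le S R J u"
      using J Q by (simp add: rough_le_iff)
    then show "J \<sqsubseteq>\<^bsub>rough_order S R\<lparr>carrier := K\<rparr>\<^esub> u" by (simp add: rough_order_def)
  }
qed (use assms in \<open>simp_all add: rough_order_def\<close>)

lemma greatest_Lower_rough_order:
  assumes Q: "x \<in> Q" "y \<in> Q" "M \<in> Q"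
    and M: "obj_low M = obj_low x \<inter> obj_low y" "obj_upp M = obj_upp x \<inter> obj_upp y"
  shows "greatest (rough_order S R) M (Lower (rough_order S R) {x, y})"
proof (rule greatest_LowerI)
  fix a assume "a \<in> {x, y}"
  then have "rough_le S R M a"
    using M Q by (elim insertE emptyE) (simp_all add: rough_le_iff)
  then show "M \<sqsubseteq>\<^bsub>rough_order S R\<^esub> a" by (simp add: rough_order_def)
next
  fix u assume "u \<in> Lower (rough_order S R) {x, y}"
  then have "u \<in> Q" "rough_le S R u x" "rough_le S R u y"
    using Q by (simp_all add: Lower_def rough_order_def)
  then have "rough_le S R u M"
    using M Q by (simp add: rough_le_iff)
  then show "u \<sqsubseteq>\<^bsub>rough_order S R\<^esub> M" by (simp add: rough_order_def)
qed (use assms in \<open>simp_all add: rough_order_def\<close>)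

lemma rough_join_props:
  assumes "x \<in> Q" "y \<in> Q"
  shows "x \<squnion>\<^bsub>rough_order S R\<^esub> y \<in> Q"
    "obj_low (x \<squnion>\<^bsub>rough_order S R\<^esub> y) = obj_low x \<union> obj_low y"
    "obj_upp (x \<squnion>\<^bsub>rough_order S R\<^esub> y) = obj_upp x \<union> obj_upp y"
proof -
  obtain J where J: "J \<in> Q" "obj_low J = obj_low x \<union> obj_low y"
      "obj_upp J = obj_upp x \<union> obj_upp y"
    using assms ex_join cls_in by (elim objE) (metis obj_low_cls obj_upp_cls)
  then have "least (rough_order S R) J (Upper (rough_order S R) {x, y})"
    using assms least_Upper_restrict[of Q x y J] by (simp add: rough_order_carrier)
  \<comment> \<open>The library join is a choice among least upper bounds; their uniqueness leaves
    \<open>J\<close> as the only candidate.\<close>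
  then have "x \<squnion>\<^bsub>rough_order S R\<^esub> y = J"
    unfolding join_def sup_def
    by (intro some_equality) (auto dest: partial_order.least_unique[OF partial_order_rough_order])
  with J show "x \<squnion>\<^bsub>rough_order S R\<^esub> y \<in> Q"
    "obj_low (x \<squnion>\<^bsub>rough_order S R\<^esub> y) = obj_low x \<union> obj_low y"
    "obj_upp (x \<squnion>\<^bsub>rough_order S R\<^esub> y) = obj_upp x \<union> obj_upp y"
    by simp_all
qed

lemma rough_meet_props:
  assumes "x \<in> Q" "y \<in> Q"
  shows "x \<sqinter>\<^bsub>rough_order S R\<^esub> y \<in> Q"
    "obj_low (x \<sqinter>\<^bsub>rough_order S R\<^esub> y) = obj_low x \<inter> obj_low y"
    "obj_upp (x \<sqinter>\<^bsub>rough_order S R\<^esub> y) = obj_upp x \<inter> obj_upp y"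
proof -
  obtain M where M: "M \<in> Q" "obj_low M = obj_low x \<inter> obj_low y"
      "obj_upp M = obj_upp x \<inter> obj_upp y"
    using assms ex_meet cls_in by (elim objE) (metis obj_low_cls obj_upp_cls)
  then have "greatest (rough_order S R) M (Lower (rough_order S R) {x, y})"
    using assms by (intro greatest_Lower_rough_order)
  then have "x \<sqinter>\<^bsub>rough_order S R\<^esub> y = M"
    unfolding meet_def inf_def
    by (intro some_equality) (auto dest: partial_order.greatest_unique[OF partial_order_rough_order])
  with M show "x \<sqinter>\<^bsub>rough_order S R\<^esub> y \<in> Q"
    "obj_low (x \<sqinter>\<^bsub>rough_order S R\<^esub> y) = obj_low x \<inter> obj_low y"
    "obj_upp (x \<sqinter>\<^bsub>rough_order S R\<^esub> y) = obj_upp x \<inter> obj_upp y"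
    by simp_all
qed

section \<open>Identities valid for all rough objects\<close>

lemmas obj_props = rough_L_props rough_U_props rough_join_props rough_meet_props

text \<open>The coordinates \<open>(l, u)\<close> become \<open>(l, l)\<close>, and \<open>l\<close>
  is contained in \<open>u\<close>.\<close>

lemma rough_L_le: "x \<in> Q \<Longrightarrow> rough_le S R (rough_L S R x) x"
  by (simp add: rough_le_iff rough_L_props obj_low_subset_upp)

lemma rough_L_L: "x \<in> Q \<Longrightarrow> rough_L S R (rough_L S R x) = rough_L S R x"
  by (rule obj_eqI) (simp_all add: obj_props)

lemma rough_U_L: "x \<in> Q \<Longrightarrow> rough_U S R (rough_L S R x) = rough_L S R x"
  by (rule obj_eqI) (simp_all add: obj_props)

lemma rough_L_one: "rough_L S R (cls S) = cls S"
  by (simp add: rough_L_class low_space)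

text \<open>On either side both coordinates are the intersection of the two lower
  components.\<close>

lemma rough_L_meet:
  "x \<in> Q \<Longrightarrow> y \<in> Q \<Longrightarrow> rough_L S R (x \<sqinter>\<^bsub>rough_order S R\<^esub> y)
    = rough_L S R x \<sqinter>\<^bsub>rough_order S R\<^esub> rough_L S R y"
  by (rule obj_eqI) (simp_all add: obj_props)

lemma rough_L_join:
  "x \<in> Q \<Longrightarrow> y \<in> Q \<Longrightarrow> rough_L S R (x \<squnion>\<^bsub>rough_order S R\<^esub> y)
    = rough_L S R x \<squnion>\<^bsub>rough_order S R\<^esub> rough_L S R y"
  by (rule obj_eqI) (simp_all add: obj_props)

lemma rough_absorb:
  "x \<in> Q \<Longrightarrow> y \<in> Q \<Longrightarrow> x \<squnion>\<^bsub>rough_order S R\<^esub> (y \<sqinter>\<^bsub>rough_order S R\<^esub> x) = x"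
  by (rule obj_eqI) (simp_all add: obj_props Un_absorb2)

text \<open>Distributivity is inherited from union and intersection in each coordinate.\<close>

lemma rough_join_meet_distrib:
  "x \<in> Q \<Longrightarrow> y \<in> Q \<Longrightarrow> z \<in> Q \<Longrightarrow> x \<squnion>\<^bsub>rough_order S R\<^esub> (y \<sqinter>\<^bsub>rough_order S R\<^esub> z)
    = (x \<squnion>\<^bsub>rough_order S R\<^esub> y) \<sqinter>\<^bsub>rough_order S R\<^esub> (x \<squnion>\<^bsub>rough_order S R\<^esub> z)"
  by (rule obj_eqI) (simp_all add: obj_props Un_Int_distrib)

lemma rough_meet_join_distrib:
  "x \<in> Q \<Longrightarrow> y \<in> Q \<Longrightarrow> z \<in> Q \<Longrightarrow> x \<sqinter>\<^bsub>rough_order S R\<^esub> (y \<squnion>\<^bsub>rough_order S R\<^esub> z)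
    = (x \<sqinter>\<^bsub>rough_order S R\<^esub> y) \<squnion>\<^bsub>rough_order S R\<^esub> (x \<sqinter>\<^bsub>rough_order S R\<^esub> z)"
  by (rule obj_eqI) (simp_all add: obj_props Int_Un_distrib)

lemmas rough_identities = rough_L_le rough_L_L rough_U_L rough_L_one rough_L_meet rough_L_join
  rough_absorb rough_join_meet_distrib rough_meet_join_distrib

section \<open>Closure properties of L-filters\<close>

context
  fixes K :: "'a set set set"
  assumes K: "L_filter S R K"
begin

lemma filter_in: "x \<in> K \<Longrightarrow> x \<in> Q"
  using K by (auto simp: L_filter_def)

lemma filter_up: "x \<in> K \<Longrightarrow> y \<in> Q \<Longrightarrow> obj_low x \<subseteq> obj_low y \<Longrightarrow> obj_upp x \<subseteq> obj_upp y \<Longrightarrow> y \<in> K"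
  using K rough_le_iff[OF filter_in, of x y] by (auto simp: L_filter_def)

lemma filter_L: "x \<in> K \<Longrightarrow> rough_L S R x \<in> K"
  using K by (auto simp: L_filter_def)

lemma filter_U: "x \<in> K \<Longrightarrow> rough_U S R x \<in> K"
  by (rule filter_up[of x]) (auto simp: obj_props filter_in intro: subsetD[OF obj_low_subset_upp])

lemma filter_join: "x \<in> K \<Longrightarrow> y \<in> K \<Longrightarrow> x \<squnion>\<^bsub>rough_order S R\<^esub> y \<in> K"
  by (rule filter_up[of x]) (auto simp: obj_props filter_in)

text \<open>An L-filter is nonempty, and the class of the whole space lies above each of its
  elements.\<close>

lemma filter_one: "cls S \<in> K"
proof -
  obtain x where x: "x \<in> K" using K by (auto simp: L_filter_def)
  then obtain A where A: "A \<subseteq> S" "x = cls A" using filter_in objE by metis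
  show ?thesis
    by (rule filter_up[OF x])
      (use A lower_approx_subset[OF equiv] upper_approx_subset[OF equiv] in
        \<open>auto simp: cls_in low_space upp_space\<close>)
qed

lemma filter_join_least:
  assumes "x \<in> K" "y \<in> K"
  shows "least (rough_order S R\<lparr>carrier := K\<rparr>) (x \<squnion>\<^bsub>rough_order S R\<^esub> y)
    (Upper (rough_order S R\<lparr>carrier := K\<rparr>) {x, y})"
  using assms by (intro least_Upper_restrict) (auto simp: filter_in filter_join rough_join_props)

lemma upper_semilattice_filter: "upper_semilattice (rough_order S R\<lparr>carrier := K\<rparr>)"
proof -
  have "partial_order (rough_order S R\<lparr>carrier := K\<rparr>)"
    using partial_order_restrict filter_in by blast
  then show ?thesis
    by (rule upper_semilattice.intro)
      (unfold_locales, use filter_join_least in auto)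
qed

lemmas filter_closed = filter_L filter_U filter_join filter_one

text \<open>Closure makes \<open>Lo\<close>, \<open>Up\<close>, \<open>Join\<close> and
  \<open>One\<close> defined throughout \<open>K\<close>, which yields the strong equations. In the
  equations to be proved only \<open>Meet\<close> can lead out of \<open>K\<close>, hence their weak
  form.\<close>

lemmas partial_eq_simps =
  weak_eq_def strong_eq_def restrict_value_def bind_eq_Some_conv filter_closed

end

end

section \<open>An L-filter over the discrete two-point space\<close>

lemma two_point_counterexample:
  fixes S :: "nat set"
  defines "S \<equiv> {0, 1}" and "R \<equiv> Id_on S"
  defines "K \<equiv> rough_objects S R - {rough_class S R {}}"
  shows "finite_approx_space S R" "L_filter S R K"
    "\<exists>x\<in>K. \<exists>y\<in>K. x \<sqinter>\<^bsub>rough_order S R\<^esub> y \<notin> K" "\<exists>x\<in>K. rough_neg S R x \<notin> K"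
proof -
  have equiv: "equiv S R"
    by (auto simp: R_def intro!: equivI refl_onI symI transI)
  then interpret approx_space S R by unfold_locales
  \<comment> \<open>Classes of the identity are singletons, so every subset is a union of
    classes.\<close>
  have low: "low A = A" and upp: "upp A = A" if "A \<subseteq> S" for A
    by (rule saturated_fixed[OF that], force simp: R_def)+
  have eq: "cls A = cls B \<longleftrightarrow> A = B" if "A \<subseteq> S" "B \<subseteq> S" for A B
    using that low by (metis obj_low_cls)
  have K: "cls A \<in> K \<longleftrightarrow> A \<noteq> {}" if "A \<subseteq> S" for A
    using that eq[OF that] cls_in[OF that] by (simp add: K_def)
  have KQ: "x \<in> Q" if "x \<in> K" for x
    using that by (simp add: K_def)
  show "finite_approx_space S R"
    using equiv by (simp add: finite_approx_space_def S_def)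
  have "cls S \<in> K" using K[of S] by (simp add: S_def)
  moreover have "y \<in> K" if "x \<in> K" "y \<in> Q" "rough_le S R x y" for x y
  proof -
    obtain A B where "A \<subseteq> S" "x = cls A" "B \<subseteq> S" "y = cls B"
      using KQ[OF \<open>x \<in> K\<close>] \<open>y \<in> Q\<close> by (elim objE)
    \<comment> \<open>The order is plain inclusion here, and a superset of a nonempty set is
      nonempty.\<close>
    with that K show ?thesis by (auto simp: rough_le_class low)
  qed
  moreover have "rough_L S R x \<in> K" if x: "x \<in> K" for x
  proof -
    obtain A where "A \<subseteq> S" "x = cls A" using KQ[OF x] by (rule objE)
    with x show ?thesis by (simp add: rough_L_class low)
  qed
  ultimately show "L_filter S R K"
    by (auto simp: L_filter_def K_def)
  have pts: "{0} \<subseteq> S" "{1} \<subseteq> S" by (simp_all add: S_def)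
  \<comment> \<open>The singletons are disjoint, so both coordinates of the meet are empty, as are
    those of the object removed from \<open>Q\<close>.\<close>
  then have "cls {0} \<sqinter>\<^bsub>rough_order S R\<^esub> cls {1} = cls {}"
    by (intro obj_eqI) (simp_all add: rough_meet_props cls_in low upp)
  then show "\<exists>x\<in>K. \<exists>y\<in>K. x \<sqinter>\<^bsub>rough_order S R\<^esub> y \<notin> K"
    using K[of "{0}"] K[of "{1}"] K[of "{}"] pts
    by (intro bexI[of _ "cls {0}"] bexI[of _ "cls {1}"]) simp_all
  \<comment> \<open>Negation sends the top to the removed object, since the complement of the whole
    space is empty.\<close>
  show "\<exists>x\<in>K. rough_neg S R x \<notin> K"
    using \<open>cls S \<in> K\<close> K[of "{}"] rough_neg_class[OF equiv, of S] by (intro bexI[of _ "cls S"]) auto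
qed

theorem proposition12:
  shows "(\<forall>(S :: 'a set) R K. finite_approx_space S R \<and> L_filter S R K \<longrightarrow>
      upper_semilattice (rough_order S R\<lparr>carrier := K\<rparr>) \<and>
      (\<forall>x\<in>K. \<forall>y\<in>K. x \<squnion>\<^bsub>rough_order S R\<^esub> y \<in> K \<and>
         least (rough_order S R\<lparr>carrier := K\<rparr>) (x \<squnion>\<^bsub>rough_order S R\<^esub> y)
           (Upper (rough_order S R\<lparr>carrier := K\<rparr>) {x, y})) \<and>
      (\<forall>x\<in>K. rough_L S R x \<in> K) \<and>
      (\<forall>x\<in>K. rough_U S R x \<in> K) \<and>
      (\<forall>x\<in>K. rough_le S R (rough_L S R x) x) \<and>
      (\<forall>a\<in>K. \<forall>b\<in>K. weak_eq S R K
         (Lo (Meet (Elem a) (Elem b))) (Meet (Lo (Elem a)) (Lo (Elem b)))) \<and>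
      (\<forall>x\<in>K. strong_eq S R K (Lo (Lo (Elem x))) (Lo (Elem x))) \<and>
      strong_eq S R K (Lo One) One \<and>
      (\<forall>x\<in>K. strong_eq S R K (Up (Lo (Elem x))) (Lo (Elem x))) \<and>
      (\<forall>a\<in>K. \<forall>b\<in>K. strong_eq S R K
         (Lo (Join (Elem a) (Elem b))) (Join (Lo (Elem a)) (Lo (Elem b)))) \<and>
      (\<forall>x\<in>K. \<forall>y\<in>K. weak_eq S R K (Join (Elem x) (Meet (Elem y) (Elem x))) (Elem x)) \<and>
      (\<forall>x\<in>K. \<forall>y\<in>K. \<forall>z\<in>K. weak_eq S R K
         (Join (Elem x) (Meet (Elem y) (Elem z)))
         (Meet (Join (Elem x) (Elem y)) (Join (Elem x) (Elem z)))) \<and>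
      (\<forall>x\<in>K. \<forall>y\<in>K. \<forall>z\<in>K. weak_eq S R K
         (Meet (Elem x) (Join (Elem y) (Elem z)))
         (Join (Meet (Elem x) (Elem y)) (Meet (Elem x) (Elem z)))))
    \<and> (\<exists>(S :: nat set) R K. finite_approx_space S R \<and> L_filter S R K \<and>
        (\<exists>x\<in>K. \<exists>y\<in>K. x \<sqinter>\<^bsub>rough_order S R\<^esub> y \<notin> K))
    \<and> (\<exists>(S :: nat set) R K. finite_approx_space S R \<and> L_filter S R K \<and>
        (\<exists>x\<in>K. rough_neg S R x \<notin> K))"
proof (rule conjI[OF _ conjI], intro allI impI, goal_cases)
  case (1 S R K)
  then interpret approx_space S R
    by (simp add: approx_space_def finite_approx_space_def)
  have K: "L_filter S R K" using 1 ..
  show ?case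
    \<comment> \<open>The clauses on order and closure are matched by rules; the equations that
      remain become identities of \<open>Q\<close> once definedness is unfolded.\<close>
    by (intro conjI ballI upper_semilattice_filter filter_join filter_join_least filter_L filter_U
        rough_L_le filter_in[OF K] K)
      (simp_all add: partial_eq_simps[OF K] rough_identities filter_in[OF K])
\<comment> \<open>One filter refutes both closures.\<close>
qed (use two_point_counterexample in blast)+

end
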